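(* Let $G_7$ be the graph with vertex set $\{x_1,\dots,x_8\}$ and edge set $\{x_1x_2, x_1x_3, x_2x_3, x_4x_5, x_4x_6, x_5x_6, x_1x_4, x_2x_5, x_3x_6, x_1x_7, x_5x_7, x_2x_8, x_4x_8\}$. Let $G$ be a clique expansion of $G_7$, and assume that every proper induced subgraph $G'$ of $G$ satisfies $\chi(G')\le \lceil\frac{5}{4}\omega(G')\rceil$. Then $\chi(G)\le \lceil\frac{5}{4}\omega(G)\rceil$.
   Context: A clique expansion of a graph $H$ is any graph $G$ whose vertex set can be partitioned into $|V(H)|$ non-empty cliques $Q_v$, $v\in V(H)$, such that every vertex of $Q_u$ is adjacent to every vertex of $Q_v$ whenever $uv\in E(H)$, and no vertex of $Q_u$ is adjacent to any vertex of $Q_v$ whenever $u\neq v$ and $uv\notin E(H)$. $\chi$ denotes the chromatic number and $\omega$ the clique number. *)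

theory Defs
  imports Complex_Main "HOL-Library.Disjoint_Sets"
    "Graph_Theory.Pair_Digraph" "Graph_Theory.Digraph_Component"
begin

text \<open>
  A finite simple undirected graph is a \<^locale>\<open>pair_graph\<close>: a finite, loop-free, symmetric digraph
  without parallel arcs, in which an edge \<open>uv\<close> is the pair of arcs \<open>(u,v)\<close>, \<open>(v,u)\<close>.
\<close>

definition is_clique :: "'a pair_pre_digraph \<Rightarrow> 'a set \<Rightarrow> bool" where
  "is_clique G K \<longleftrightarrow>
     K \<subseteq> pverts G \<and> (\<forall>u\<in>K. \<forall>v\<in>K. u \<noteq> v \<longrightarrow> (u, v) \<in> parcs G)"

definition clique_number :: "'a pair_pre_digraph \<Rightarrow> nat" where
  "clique_number G = Max (card ` {K. is_clique G K})"

definition is_coloring :: "'a pair_pre_digraph \<Rightarrow> nat \<Rightarrow> ('a \<Rightarrow> nat) \<Rightarrow> bool" where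
  "is_coloring G k f \<longleftrightarrow>
     f ` pverts G \<subseteq> {..<k} \<and> (\<forall>(u, v)\<in>parcs G. f u \<noteq> f v)"

definition chromatic_number :: "'a pair_pre_digraph \<Rightarrow> nat" where
  "chromatic_number G = (LEAST k. \<exists>f. is_coloring G k f)"

definition clique_expansion :: "'b pair_pre_digraph \<Rightarrow> 'a pair_pre_digraph \<Rightarrow> bool" where
  "clique_expansion H G \<longleftrightarrow>
     (\<exists>Q :: 'b \<Rightarrow> 'a set.
        (\<Union>v\<in>pverts H. Q v) = pverts G \<and>
        disjoint_family_on Q (pverts H) \<and>
        (\<forall>v\<in>pverts H. Q v \<noteq> {} \<and> is_clique G (Q v)) \<and>
        (\<forall>u\<in>pverts H. \<forall>v\<in>pverts H. (u, v) \<in> parcs H \<longrightarrow>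
           (\<forall>x\<in>Q u. \<forall>y\<in>Q v. (x, y) \<in> parcs G)) \<and>
        (\<forall>u\<in>pverts H. \<forall>v\<in>pverts H. u \<noteq> v \<and> (u, v) \<notin> parcs H \<longrightarrow>
           (\<forall>x\<in>Q u. \<forall>y\<in>Q v. (x, y) \<notin> parcs G)))"

text \<open>The vertex \<open>x\<^sub>i\<close> is the number \<open>i\<close>; \<^const>\<open>symcl\<close> adds the reverse of each listed pair.\<close>

definition G7 :: "nat pair_pre_digraph" where
  "G7 = \<lparr> pverts = {1..8},
          parcs = symcl {(1,2), (1,3), (2,3), (4,5), (4,6), (5,6), (1,4), (2,5), (3,6),
                         (1,7), (5,7), (2,8), (4,8)} \<rparr>"

lemma pair_graph_G7: "pair_graph G7"
  by unfold_locales
    (auto simp: G7_def symcl_def symmetric_def arcs_ends_conv sym_def)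

end

theory Submission
  imports Defs
begin

text \<open>
  It suffices to find \<open>k\<close> stable sets whose removal lowers \<open>\<omega>\<close> by some \<open>m\<close> with
  \<open>4k \<le> 5m\<close>, since induction then applies to the rest. If a single stable set meets all maximum
  cliques, take \<open>k = m = 1\<close>. Testing this on the maximal stable sets of \<open>G\<^sub>7\<close> leaves only the
  weights \<open>(a, b, a+b, b, a, a+b, a+2b, 2a+b)\<close> with \<open>\<omega> = 2(a+b)\<close>, and there the five stable sets
  \<open>{x\<^sub>1,x\<^sub>6,x\<^sub>8}\<close>, \<open>{x\<^sub>2,x\<^sub>6,x\<^sub>7}\<close>, \<open>{x\<^sub>3,x\<^sub>4,x\<^sub>7}\<close>, \<open>{x\<^sub>3,x\<^sub>5,x\<^sub>8}\<close>, \<open>{x\<^sub>7,x\<^sub>8}\<close> lower \<open>\<omega>\<close> by 4.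
\<close>

section \<open>Cliques, colourings and vertex deletion\<close>

definition delete_verts :: "'a pair_pre_digraph \<Rightarrow> 'a set \<Rightarrow> 'a pair_pre_digraph" where
  "delete_verts G R =
     \<lparr> pverts = pverts G - R, parcs = {(u, v) \<in> parcs G. u \<notin> R \<and> v \<notin> R} \<rparr>"

lemma delete_verts_simps [simp]:
  "pverts (delete_verts G R) = pverts G - R"
  "parcs (delete_verts G R) = {(u, v) \<in> parcs G. u \<notin> R \<and> v \<notin> R}"
  by (simp_all add: delete_verts_def)

lemma is_clique_delete_verts: "is_clique (delete_verts G R) K \<longleftrightarrow> is_clique G K \<and> K \<inter> R = {}"
  by (auto simp: is_clique_def)

lemma finite_cliques: "finite (pverts G) \<Longrightarrow> finite {K. is_clique G K}"
  by (rule finite_subset[of _ "Pow (pverts G)"]) (auto simp: is_clique_def)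

lemma clique_number_le:
  assumes "finite (pverts G)" and "\<And>K. is_clique G K \<Longrightarrow> card K \<le> n"
  shows "clique_number G \<le> n"
proof -
  have "is_clique G {}" by (simp add: is_clique_def)
  then show ?thesis
    unfolding clique_number_def using finite_cliques[OF assms(1)] assms(2)
    by (subst Max_le_iff) auto
qed

lemma card_le_clique_number:
  assumes "finite (pverts G)" and "is_clique G K"
  shows "card K \<le> clique_number G"
  unfolding clique_number_def using finite_cliques[OF assms(1)] assms(2) by (intro Max_ge) auto

lemma chromatic_number_le: "is_coloring G k f \<Longrightarrow> chromatic_number G \<le> k"
  unfolding chromatic_number_def by (rule Least_le) blast

lemma chromatic_number_attained:
  assumes "is_coloring G k f"
  obtains f' where "is_coloring G (chromatic_number G) f'"
  using LeastI[of "\<lambda>k. \<exists>f. is_coloring G k f" k] assms unfolding chromatic_number_def by blast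

context pair_graph
begin

lemma induced_subgraph_delete_verts:
  "induced_subgraph (with_proj (delete_verts G R)) (with_proj G)"
proof -
  have "wf_digraph (with_proj (delete_verts G R))"
    by unfold_locales (auto dest: in_arcsD1 in_arcsD2)
  then show ?thesis
    using wf_digraph_axioms
    by (auto simp: induced_subgraph_def subgraph_def compatible_def dest: in_arcsD1 in_arcsD2)
qed

text \<open>Giving distinct colours to all vertices works because there are no loops. Some colouring
  must exist before the \<open>LEAST\<close> in \<open>chromatic_number\<close> is known to be
  attained.\<close>

lemma ex_coloring: "\<exists>f. is_coloring G (card (pverts G)) f"
proof -
  obtain f where f: "bij_betw f (pverts G) {0..<card (pverts G)}"
    using ex_bij_betw_finite_nat pair_finite_verts by blast
  have "f u \<noteq> f v" if "(u, v) \<in> parcs G" for u v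
    using that bij_betw_imp_inj_on[OF f] pair_no_loops[OF that]
      in_arcsD1[OF that] in_arcsD2[OF that]
    by (auto dest: inj_onD)
  then have "is_coloring G (card (pverts G)) f"
    using f by (auto simp: is_coloring_def bij_betw_def)
  then show ?thesis by blast
qed

text \<open>Colour \<open>R\<close> by \<open>g\<close> and the rest optimally with colours shifted
  up by \<open>k\<close>: the two palettes are disjoint, so arcs between \<open>R\<close> and the
  rest cause no conflict.\<close>

lemma chromatic_number_le_delete_verts:
  assumes g: "g ` R \<subseteq> {..<k}" "\<And>u v. (u, v) \<in> parcs G \<Longrightarrow> u \<in> R \<Longrightarrow> v \<in> R \<Longrightarrow> g u \<noteq> g v"
  shows "chromatic_number G \<le> k + chromatic_number (delete_verts G R)"
proof -
  obtain f' where "is_coloring G (card (pverts G)) f'"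
    using ex_coloring by blast
  then have "is_coloring (delete_verts G R) (card (pverts G)) f'"
    unfolding is_coloring_def delete_verts_simps by blast
  then obtain f where
    f: "is_coloring (delete_verts G R) (chromatic_number (delete_verts G R)) f"
    by (rule chromatic_number_attained)
  define h where "h x = (if x \<in> R then g x else k + f x)" for x
  have g_less: "g x < k" if "x \<in> R" for x
    using g(1) that by auto
  have "h u \<noteq> h v" if "(u, v) \<in> parcs G" for u v
    using that f g(2)[OF that] g_less[of u] g_less[of v]
    by (auto simp: h_def is_coloring_def)
  moreover have "h x < k + chromatic_number (delete_verts G R)" if "x \<in> pverts G" for x
    using that f g_less[of x] by (auto simp: h_def is_coloring_def image_subset_iff)
  ultimately have "is_coloring G (k + chromatic_number (delete_verts G R)) h"
    by (auto simp: is_coloring_def)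
  then show ?thesis
    by (rule chromatic_number_le)
qed

end

section \<open>Clique expansions as weighted graphs\<close>

locale clique_expansion_parts = pair_graph G for G :: "'a pair_pre_digraph" +
  fixes H :: "'b pair_pre_digraph" and Q :: "'b \<Rightarrow> 'a set"
  assumes finite_H: "finite (pverts H)"
    and Union_Q: "(\<Union>v\<in>pverts H. Q v) = pverts G"
    and disjoint_Q: "disjoint_family_on Q (pverts H)"
    and clique_Q: "v \<in> pverts H \<Longrightarrow> is_clique G (Q v)"
    and complete_Q: "(u, v) \<in> parcs H \<Longrightarrow> u \<in> pverts H \<Longrightarrow> v \<in> pverts H \<Longrightarrow>
      x \<in> Q u \<Longrightarrow> y \<in> Q v \<Longrightarrow> (x, y) \<in> parcs G"
    and anticomplete_Q: "u \<in> pverts H \<Longrightarrow> v \<in> pverts H \<Longrightarrow> u \<noteq> v \<Longrightarrow> (u, v) \<notin> parcs H \<Longrightarrow>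
      x \<in> Q u \<Longrightarrow> y \<in> Q v \<Longrightarrow> (x, y) \<notin> parcs G"
begin

lemma finite_Q: "v \<in> pverts H \<Longrightarrow> finite (Q v)"
  using pair_finite_verts unfolding Union_Q[symmetric] by (rule finite_subset[rotated]) blast

lemma Q_inj: "x \<in> Q u \<Longrightarrow> x \<in> Q v \<Longrightarrow> u \<in> pverts H \<Longrightarrow> v \<in> pverts H \<Longrightarrow> u = v"
  using disjoint_Q unfolding disjoint_family_on_def by blast

text \<open>The parts over a clique of \<open>H\<close> join up to a clique of \<open>G\<close>, and
  disjointness turns its size into the sum.\<close>

lemma sum_card_le_clique_number:
  assumes "is_clique H M"
  shows "(\<Sum>v\<in>M. card (Q v)) \<le> clique_number G"
proof -
  have M: "M \<subseteq> pverts H" using assms by (simp add: is_clique_def)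
  have "is_clique G (\<Union>v\<in>M. Q v)"
    unfolding is_clique_def
  proof (intro conjI ballI impI)
    show "(\<Union>v\<in>M. Q v) \<subseteq> pverts G" using M Union_Q by blast
    fix x y assume "x \<in> (\<Union>v\<in>M. Q v)" "y \<in> (\<Union>v\<in>M. Q v)" "x \<noteq> y"
    then obtain u v where uv: "u \<in> M" "v \<in> M" "x \<in> Q u" "y \<in> Q v" by blast
    show "(x, y) \<in> parcs G"
    proof (cases "u = v")
      case True
      then show ?thesis using uv M \<open>x \<noteq> y\<close> clique_Q[of u] by (auto simp: is_clique_def)
    next
      case False
      then show ?thesis using uv M assms by (intro complete_Q[of u v]) (auto simp: is_clique_def)
    qed
  qed
  then have "card (\<Union>v\<in>M. Q v) \<le> clique_number G"
    using pair_finite_verts by (rule card_le_clique_number[rotated])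
  also have "card (\<Union>v\<in>M. Q v) = (\<Sum>v\<in>M. card (Q v))"
    using M finite_subset[OF M finite_H] finite_Q Q_inj
    by (intro card_UN_disjoint) blast+
  finally show ?thesis .
qed

text \<open>The parts met by \<open>K\<close> are pairwise adjacent in \<open>H\<close>, since
  vertices in nonadjacent parts are nonadjacent. Keeping \<open>Q v \<inter> K\<close> in the bound,
  instead of \<open>Q v\<close>, allows a sharper estimate when \<open>K\<close> avoids removed
  vertices.\<close>

lemma card_clique_le_sum:
  assumes "is_clique G K"
  obtains M where "is_clique H M" "card K \<le> (\<Sum>v\<in>M. card (Q v \<inter> K))"
proof
  define M where "M = {v \<in> pverts H. Q v \<inter> K \<noteq> {}}"
  show "is_clique H M"
    unfolding is_clique_def
  proof (intro conjI ballI impI)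
    show "M \<subseteq> pverts H" by (auto simp: M_def)
    fix u v assume uv: "u \<in> M" "v \<in> M" "u \<noteq> v"
    then obtain x y where xy: "x \<in> Q u" "x \<in> K" "y \<in> Q v" "y \<in> K" by (auto simp: M_def)
    then have "x \<noteq> y" using Q_inj[of x u v] uv by (auto simp: M_def)
    then have "(x, y) \<in> parcs G" using assms xy by (auto simp: is_clique_def)
    then show "(u, v) \<in> parcs H" using uv xy anticomplete_Q[of u v x y] by (auto simp: M_def)
  qed
  have "\<exists>v\<in>M. x \<in> Q v" if "x \<in> K" for x
  proof -
    have "x \<in> (\<Union>v\<in>pverts H. Q v)"
      using assms that unfolding Union_Q is_clique_def by blast
    with that show ?thesis unfolding M_def by blast
  qed
  then have "K = (\<Union>v\<in>M. Q v \<inter> K)" by blast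
  then have "card K = card (\<Union>v\<in>M. Q v \<inter> K)" by simp
  also have "\<dots> \<le> (\<Sum>v\<in>M. card (Q v \<inter> K))"
    using finite_H by (intro card_UN_le) (auto simp: M_def)
  finally show "card K \<le> (\<Sum>v\<in>M. card (Q v \<inter> K))" .
qed

text \<open>
  The colours in \<open>C v\<close> are given to distinct vertices of \<open>Q v\<close>; thus colour \<open>i < k\<close> is used on
  the stable set \<open>{v. i \<in> C v}\<close> of \<open>H\<close>.
\<close>

lemma chromatic_number_le_by_removal:
  assumes IH: "\<And>G' :: 'a pair_pre_digraph.
      induced_subgraph (with_proj G') (with_proj G) \<Longrightarrow> G' \<noteq> G \<Longrightarrow>
      int (chromatic_number G') \<le> \<lceil>5 / 4 * real (clique_number G')\<rceil>"
    and C: "\<And>v. v \<in> pverts H \<Longrightarrow> C v \<subseteq> {..<k}"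
    and card_C: "\<And>v. v \<in> pverts H \<Longrightarrow> card (C v) \<le> card (Q v)"
    and proper_C: "\<And>u v. (u, v) \<in> parcs H \<Longrightarrow> C u \<inter> C v = {}"
    and nonempty_C: "\<exists>v\<in>pverts H. C v \<noteq> {}"
    and drop: "\<And>M. is_clique H M \<Longrightarrow>
      (\<Sum>v\<in>M. card (Q v) - card (C v)) + m \<le> clique_number G"
    and ratio: "4 * k \<le> 5 * m"
  shows "int (chromatic_number G) \<le> \<lceil>5 / 4 * real (clique_number G)\<rceil>"
proof -
  have fin_C: "finite (C v)" if "v \<in> pverts H" for v
    using C[OF that] finite_subset by blast
  have "\<exists>e. inj_on e (C v) \<and> e ` C v \<subseteq> Q v" if "v \<in> pverts H" for v
    using card_le_inj[OF fin_C finite_Q card_C] that by metis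
  then obtain e where e: "\<And>v. v \<in> pverts H \<Longrightarrow> inj_on (e v) (C v) \<and> e v ` C v \<subseteq> Q v"
    by metis
  define R where "R = (\<Union>v\<in>pverts H. e v ` C v)"
  \<comment> \<open>A removed vertex \<open>x\<close> remembers its part \<open>p x\<close> and the
    colour \<open>g x\<close> that it represents there.\<close>
  have "\<exists>i v. v \<in> pverts H \<and> i \<in> C v \<and> x = e v i" if "x \<in> R" for x
    using that by (auto simp: R_def)
  then obtain g p where gp: "\<And>x. x \<in> R \<Longrightarrow> p x \<in> pverts H \<and> g x \<in> C (p x) \<and> x = e (p x) (g x)"
    by metis
  have in_Q: "x \<in> Q (p x)" if "x \<in> R" for x
    using gp[OF that] e by (metis image_subset_iff)
  have chi: "chromatic_number G \<le> k + chromatic_number (delete_verts G R)"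
  proof (rule chromatic_number_le_delete_verts)
    show "g ` R \<subseteq> {..<k}" using gp C by blast
    fix u v assume uv: "(u, v) \<in> parcs G" "u \<in> R" "v \<in> R"
    show "g u \<noteq> g v"
    proof
      assume eq: "g u = g v"
      \<comment> \<open>Within one part, equal colours would give \<open>u = v\<close>, as both
        equal \<open>e (p u) (g u)\<close>; this is excluded since \<open>(u, v)\<close> is not a
        loop.\<close>
      have ne: "p u \<noteq> p v"
        using gp[OF uv(2)] gp[OF uv(3)] eq pair_no_loops[OF uv(1)] by force
      have "(p u, p v) \<in> parcs H"
        using anticomplete_Q[OF _ _ ne _ in_Q in_Q] gp uv by blast
      then show False
        using proper_C[of "p u" "p v"] gp[OF uv(2)] gp[OF uv(3)] eq by auto
    qed
  qed
  have "R \<subseteq> pverts G"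
    using e unfolding R_def Union_Q[symmetric] by blast
  moreover have "R \<noteq> {}"
    using nonempty_C by (simp add: R_def)
  ultimately have "pverts (delete_verts G R) \<noteq> pverts G" by auto
  then have ne: "delete_verts G R \<noteq> G" by metis
  have card_rest: "card (Q v - R) \<le> card (Q v) - card (C v)" if "v \<in> pverts H" for v
  proof -
    have "card (Q v - R) \<le> card (Q v - e v ` C v)"
      using that finite_Q by (intro card_mono) (auto simp: R_def)
    also have "\<dots> = card (Q v) - card (C v)"
      using that e[OF that] fin_C[OF that]
      by (subst card_Diff_subset) (auto simp: card_image)
    finally show ?thesis .
  qed
  \<comment> \<open>The empty clique already forces this; it makes the truncated difference
    \<open>clique_number G - m\<close> exact.\<close>
  have m_le: "m \<le> clique_number G"
    using drop[of "{}"] by (simp add: is_clique_def)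
  have "clique_number (delete_verts G R) \<le> clique_number G - m"
  proof (rule clique_number_le)
    show "finite (pverts (delete_verts G R))" using pair_finite_verts by simp
    fix K assume "is_clique (delete_verts G R) K"
    then have K: "is_clique G K" "K \<inter> R = {}" by (auto simp: is_clique_delete_verts)
    obtain M where M: "is_clique H M" "card K \<le> (\<Sum>v\<in>M. card (Q v \<inter> K))"
      using card_clique_le_sum[OF K(1)] .
    have "card (Q v \<inter> K) \<le> card (Q v) - card (C v)" if "v \<in> M" for v
    proof -
      have v: "v \<in> pverts H" using that M(1) by (auto simp: is_clique_def)
      have "card (Q v \<inter> K) \<le> card (Q v - R)"
        using K(2) finite_Q[OF v] by (intro card_mono) auto
      with card_rest[OF v] show ?thesis by simp
    qed
    then have "(\<Sum>v\<in>M. card (Q v \<inter> K)) \<le> (\<Sum>v\<in>M. card (Q v) - card (C v))"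
      by (rule sum_mono)
    with M(2) drop[OF M(1)] show "card K \<le> clique_number G - m" by linarith
  qed
  then have omega: "real (clique_number (delete_verts G R)) \<le> real (clique_number G) - real m"
    using m_le by linarith
  have "int (chromatic_number G) \<le> int k + \<lceil>5 / 4 * real (clique_number (delete_verts G R))\<rceil>"
    using chi IH[OF induced_subgraph_delete_verts ne] by linarith
  \<comment> \<open>The integer \<open>k\<close> moves inside the ceiling, where it is absorbed by
    the loss of at least \<open>5 / 4 * m\<close> because \<open>4 * k \<le> 5 * m\<close>.\<close>
  also have "\<dots> = \<lceil>5 / 4 * real (clique_number (delete_verts G R)) + real k\<rceil>"
    by linarith
  also have "\<dots> \<le> \<lceil>5 / 4 * real (clique_number G)\<rceil>"
    using omega ratio by (intro ceiling_mono) linarith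
  finally show ?thesis .
qed

end

section \<open>The cliques of \<open>G7\<close>\<close>

lemma in_symcl_iff: "(u, v) \<in> symcl A \<longleftrightarrow> (u, v) \<in> A \<or> (v, u) \<in> A"
  by (auto simp: symcl_def image_iff)

lemma G7_arc_iff: "(u, v) \<in> parcs G7 \<longleftrightarrow>
    (u, v) \<in> {(1,2), (1,3), (2,3), (4,5), (4,6), (5,6), (1,4), (2,5), (3,6),
               (1,7), (5,7), (2,8), (4,8)} \<or>
    (v, u) \<in> {(1,2), (1,3), (2,3), (4,5), (4,6), (5,6), (1,4), (2,5), (3,6),
               (1,7), (5,7), (2,8), (4,8)}"
  unfolding G7_def by (simp only: in_symcl_iff pair_pre_digraph.simps)

text \<open>Maximal under inclusion: the two triangles and the seven edges lying in neither.\<close>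

definition G7_max_cliques :: "nat set set" where
  "G7_max_cliques =
     {{1,2,3}, {4,5,6}, {1,4}, {2,5}, {3,6}, {1,7}, {5,7}, {2,8}, {4,8}}"

lemma is_clique_G7_max: "M \<in> G7_max_cliques \<Longrightarrow> is_clique G7 M"
  unfolding G7_max_cliques_def is_clique_def G7_arc_iff
  by (elim insertE emptyE) (simp_all add: G7_def)

lemma is_clique_G7_subset:
  assumes "is_clique G7 M"
  obtains N where "N \<in> G7_max_cliques" "M \<subseteq> N"
proof -
  have sub: "M \<subseteq> {1,2,3,4,5,6,7,8}"
    using assms unfolding is_clique_def G7_def by fastforce
  have "u \<notin> M \<or> v \<notin> M" if "u \<noteq> v" "(u, v) \<notin> parcs G7" for u v
    using assms that by (auto simp: is_clique_def)
  from this[of 1 5] this[of 1 6] this[of 1 8] this[of 2 4] this[of 2 6] this[of 2 7] this[of 3 4]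
    this[of 3 5] this[of 3 7] this[of 3 8] this[of 4 7] this[of 5 8] this[of 6 7] this[of 6 8]
    this[of 7 8]
  have nonadj: "1 \<notin> M \<or> 5 \<notin> M" "1 \<notin> M \<or> 6 \<notin> M" "1 \<notin> M \<or> 8 \<notin> M" "2 \<notin> M \<or> 4 \<notin> M"
    "2 \<notin> M \<or> 6 \<notin> M" "2 \<notin> M \<or> 7 \<notin> M" "3 \<notin> M \<or> 4 \<notin> M" "3 \<notin> M \<or> 5 \<notin> M" "3 \<notin> M \<or> 7 \<notin> M"
    "3 \<notin> M \<or> 8 \<notin> M" "4 \<notin> M \<or> 7 \<notin> M" "5 \<notin> M \<or> 8 \<notin> M" "6 \<notin> M \<or> 7 \<notin> M" "6 \<notin> M \<or> 8 \<notin> M"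
    "7 \<notin> M \<or> 8 \<notin> M"
    by (simp_all add: G7_arc_iff)
  \<comment> \<open>Unfolding leaves a propositional claim in the eight atoms
    \<open>i \<in> M\<close>, decided from the 15 nonadjacent pairs. Dropping
    \<open>One_nat_def\<close> keeps the atom for 1 in the same form as in
    \<open>nonadj\<close>.\<close>
  have "\<exists>N\<in>G7_max_cliques. \<forall>v\<in>{1,2,3,4,5,6,7,8}. v \<in> N \<or> v \<notin> M"
    unfolding G7_max_cliques_def by (simp del: One_nat_def, insert nonadj, argo)
  then obtain N where N: "N \<in> G7_max_cliques" "\<forall>v\<in>{1,2,3,4,5,6,7,8}. v \<in> N \<or> v \<notin> M" ..
  have "M \<subseteq> N"
    using N(2) sub by (meson subset_iff)
  with N(1) show thesis by (rule that)
qed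

section \<open>The weights of a counterexample\<close>

theorem theorem8:
  fixes G :: "'a pair_pre_digraph"
  assumes "pair_graph G"
    and "clique_expansion G7 G"
    and "\<And>G' :: 'a pair_pre_digraph.
           induced_subgraph (with_proj G') (with_proj G) \<Longrightarrow> G' \<noteq> G \<Longrightarrow>
           int (chromatic_number G') \<le> \<lceil>5 / 4 * real (clique_number G')\<rceil>"
  shows "int (chromatic_number G) \<le> \<lceil>5 / 4 * real (clique_number G)\<rceil>"
proof (rule ccontr)
  assume counterexample: "\<not> ?thesis"
  obtain Q :: "nat \<Rightarrow> 'a set" where Q:
    "(\<Union>v\<in>pverts G7. Q v) = pverts G"
    "disjoint_family_on Q (pverts G7)"
    "\<forall>v\<in>pverts G7. Q v \<noteq> {} \<and> is_clique G (Q v)"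
    "\<forall>u\<in>pverts G7. \<forall>v\<in>pverts G7. (u, v) \<in> parcs G7 \<longrightarrow>
       (\<forall>x\<in>Q u. \<forall>y\<in>Q v. (x, y) \<in> parcs G)"
    "\<forall>u\<in>pverts G7. \<forall>v\<in>pverts G7. u \<noteq> v \<and> (u, v) \<notin> parcs G7 \<longrightarrow>
       (\<forall>x\<in>Q u. \<forall>y\<in>Q v. (x, y) \<notin> parcs G)"
    using assms(2) unfolding clique_expansion_def by (elim exE conjE)
  interpret pair_graph G by fact
  interpret clique_expansion_parts G G7 Q
  proof
    show "finite (pverts G7)" by (simp add: G7_def)
    show "(\<Union>v\<in>pverts G7. Q v) = pverts G" "disjoint_family_on Q (pverts G7)" by fact+
    show "is_clique G (Q v)" if "v \<in> pverts G7" for v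
      using Q(3) that by blast
    show "(x, y) \<in> parcs G"
      if "(u, v) \<in> parcs G7" "u \<in> pverts G7" "v \<in> pverts G7" "x \<in> Q u" "y \<in> Q v" for u v x y
      using Q(4) that by blast
    show "(x, y) \<notin> parcs G"
      if "u \<in> pverts G7" "v \<in> pverts G7" "u \<noteq> v" "(u, v) \<notin> parcs G7" "x \<in> Q u" "y \<in> Q v"
      for u v x y
      using Q(5) that by blast
  qed
  define q where "q v = card (Q v)" for v
  define w where "w = clique_number G"
  have verts: "v \<in> pverts G7 \<longleftrightarrow> v \<in> {1,2,3,4,5,6,7,8}" for v
    unfolding G7_def by auto
  have q_pos: "q v > 0" if "v \<in> pverts G7" for v
    using bspec[OF Q(3) that] finite_Q[OF that] by (simp add: q_def card_gt_0_iff)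
  then have pos: "q 1 > 0" "q 2 > 0" "q 3 > 0" "q 4 > 0" 
    "q 5 > 0" "q 6 > 0" "q 7 > 0" "q 8 > 0"
    by (simp_all add: verts)
  have sum_le: "(\<Sum>v\<in>M. q v) \<le> w" if "M \<in> G7_max_cliques" for M
    using sum_card_le_clique_number[OF is_clique_G7_max[OF that]] by (simp add: q_def w_def)
  then have "\<forall>M\<in>G7_max_cliques. (\<Sum>v\<in>M. q v) \<le> w" by blast
  then have le: "q 1 + q 2 + q 3 \<le> w" "q 4 + q 5 + q 6 \<le> w" "q 1 + q 4 \<le> w" "q 2 + q 5 \<le> w"
    "q 3 + q 6 \<le> w" "q 1 + q 7 \<le> w" "q 5 + q 7 \<le> w" "q 2 + q 8 \<le> w" "q 4 + q 8 \<le> w"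
    by (simp_all add: G7_max_cliques_def add.assoc)
  \<comment> \<open>In a counterexample no good removal exists. The drop needs checking only on the
    nine maximal cliques, as residual sums are monotone. Every maximal stable set of
    \<open>G7\<close> contains 7 or 8: the neighbours 1, 5 of 7 are all adjacent to the neighbours
    2, 4 of 8.\<close>
  have removal: False
    if "\<And>v. C v \<subseteq> {..<k}" "\<And>v. v \<in> pverts G7 \<Longrightarrow> card (C v) \<le> q v"
      "\<And>u v. (u, v) \<in> parcs G7 \<Longrightarrow> C u \<inter> C v = {}" "C 8 \<noteq> {} \<or> C 7 \<noteq> {}"
      and N: "\<And>N. N \<in> G7_max_cliques \<Longrightarrow> (\<Sum>v\<in>N. q v - card (C v)) + m \<le> w"
      and "4 * k \<le> 5 * m"
    for C :: "nat \<Rightarrow> nat set" and k m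
  proof -
    have "(\<Sum>v\<in>M. q v - card (C v)) + m \<le> w" if M: "is_clique G7 M" for M
    proof -
      obtain N where *: "N \<in> G7_max_cliques" "M \<subseteq> N"
        using is_clique_G7_subset[OF M] .
      have "finite N" using *(1) by (auto simp: G7_max_cliques_def)
      then have "(\<Sum>v\<in>M. q v - card (C v)) \<le> (\<Sum>v\<in>N. q v - card (C v))"
        using *(2) by (intro sum_mono2) auto
      with N[OF *(1)] show ?thesis by linarith
    qed
    then have "int (chromatic_number G) \<le> \<lceil>5 / 4 * real (clique_number G)\<rceil>"
      using that unfolding q_def w_def
      by (intro chromatic_number_le_by_removal[OF assms(3), of C k m]) (auto simp: verts)
    with counterexample show False ..
  qed
  \<comment> \<open>Otherwise removing one vertex from each part in \<open>S\<close> lowers the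
    clique number: cliques meeting \<open>S\<close> lose a vertex, as parts are nonempty, and those
    avoiding \<open>S\<close> are not maximum. This is \<open>k = m = 1\<close>.\<close>
  have stable: "\<exists>N\<in>G7_max_cliques. N \<inter> S = {} \<and> (\<Sum>v\<in>N. q v) = w"
    if S: "7 \<in> S \<or> 8 \<in> S" "\<forall>u\<in>S. \<forall>v\<in>S. (u, v) \<notin> parcs G7" for S
  proof (rule ccontr)
    assume *: "\<not> ?thesis"
    define C where "C v = (if v \<in> S then {0::nat} else {})" for v :: nat
    have card_C: "card (C v) = (if v \<in> S then 1 else 0)" for v
      by (simp add: C_def)
    show False
    proof (rule removal[of C 1 1])
      fix N assume N: "N \<in> G7_max_cliques"
      then have sub: "N \<subseteq> pverts G7" and fin: "finite N"
        using is_clique_G7_max by (auto simp: is_clique_def G7_max_cliques_def)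
      show "(\<Sum>v\<in>N. q v - card (C v)) + 1 \<le> w"
      proof (cases "N \<inter> S = {}")
        case True
        then have "(\<Sum>v\<in>N. q v) < w"
          using * N sum_le[OF N] by (metis le_neq_implies_less)
        moreover have "(\<Sum>v\<in>N. q v - card (C v)) \<le> (\<Sum>v\<in>N. q v)"
          by (rule sum_mono) simp
        ultimately show ?thesis by linarith
      next
        case False
        then obtain v where "v \<in> N" "v \<in> S" by blast
        then have "\<exists>v\<in>N. q v - card (C v) < q v"
          using sub q_pos[of v] by (intro bexI[of _ v]) (auto simp: card_C)
        then have "(\<Sum>v\<in>N. q v - card (C v)) < (\<Sum>v\<in>N. q v)"
          using fin by (intro sum_strict_mono_ex1) auto
        with sum_le[OF N] show ?thesis by linarith
      qed
    next
      fix v assume "v \<in> pverts G7"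
      then show "card (C v) \<le> q v" using q_pos[of v] by (simp add: card_C)
    qed (use S in \<open>auto simp: C_def\<close>)
  qed
  \<comment> \<open>Each disjunction below lists the maximal cliques that avoid the given stable
    set; for \<open>{1,5,8}\<close> only \<open>{3,6}\<close> does.\<close>
  have "q 3 + q 6 = w"
    using stable[of "{1,5,8}"] by (simp add: G7_arc_iff G7_max_cliques_def add.assoc)
  moreover have "q 2 + q 5 = w \<or> q 5 + q 7 = w"
    using stable[of "{1,6,8}"] by (simp add: G7_arc_iff G7_max_cliques_def add.assoc)
  moreover have "q 1 + q 4 = w \<or> q 4 + q 8 = w"
    using stable[of "{2,6,7}"] by (simp add: G7_arc_iff G7_max_cliques_def add.assoc)
  moreover have "q 2 + q 5 = w \<or> q 2 + q 8 = w"
    using stable[of "{3,4,7}"] by (simp add: G7_arc_iff G7_max_cliques_def add.assoc)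
  moreover have "q 1 + q 4 = w \<or> q 1 + q 7 = w"
    using stable[of "{3,5,8}"] by (simp add: G7_arc_iff G7_max_cliques_def add.assoc)
  moreover have "q 4 + q 5 + q 6 = w \<or> q 1 + q 4 = w \<or> q 2 + q 5 = w"
    using stable[of "{3,7,8}"] by (simp add: G7_arc_iff G7_max_cliques_def add.assoc)
  moreover have "q 1 + q 2 + q 3 = w \<or> q 1 + q 4 = w \<or> q 2 + q 5 = w"
    using stable[of "{6,7,8}"] by (simp add: G7_arc_iff G7_max_cliques_def add.assoc)
  \<comment> \<open>Adding the two triangle bounds and subtracting \<open>q 3 + q 6 = w\<close>
    gives \<open>(q 1 + q 4) + (q 2 + q 5) \<le> w\<close>, and both brackets are positive.\<close>
  moreover have "q 1 + q 4 \<noteq> w" "q 2 + q 5 \<noteq> w"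
    using \<open>q 3 + q 6 = w\<close> le pos by linarith+
  \<comment> \<open>All maximal cliques except \<open>{1,4}\<close> and \<open>{2,5}\<close> are now
    tight. Comparing the edges at 7 gives \<open>q 5 = q 1\<close>, those at 8 give
    \<open>q 4 = q 2\<close>, and the triangles then give \<open>q 3 = q 6\<close>.\<close>
  ultimately have weights: "q 5 = q 1" "q 4 = q 2" "q 3 = q 1 + q 2" "q 6 = q 1 + q 2"
    "q 7 = q 1 + 2 * q 2" "q 8 = 2 * q 1 + q 2" "w = 2 * q 1 + 2 * q 2"
    by linarith+
  \<comment> \<open>The five stable sets in transposed form: set number \<open>i\<close> is
    \<open>{v. i \<in> C v}\<close>. The sizes of the \<open>C v\<close> are the weights for
    \<open>q 1 = q 2 = 1\<close>, hence at most \<open>q v\<close>.\<close>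
  define C :: "nat \<Rightarrow> nat set" where
    "C v = (if v = 1 then {0} else if v = 2 then {1} else if v = 3 then {2,3}
       else if v = 4 then {2} else if v = 5 then {3} else if v = 6 then {0,1}
       else if v = 7 then {1,2,4} else if v = 8 then {0,3,4} else {})" for v
  show False
  proof (rule removal[of C 5 4])
    show "C v \<subseteq> {..<5}" for v
      by (auto simp: C_def)
    show "card (C v) \<le> q v" if "v \<in> pverts G7" for v
      using that[unfolded verts] weights pos by (auto simp: C_def)
    show "C u \<inter> C v = {}" if "(u, v) \<in> parcs G7" for u v
      using that unfolding G7_arc_iff
      by (elim disjE insertE emptyE Pair_inject) (simp_all add: C_def)
    show "C 8 \<noteq> {} \<or> C 7 \<noteq> {}"
      by (simp add: C_def)
    \<comment> \<open>Seven of the cliques lose exactly 4. \<open>{1,4}\<close> and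
      \<open>{2,5}\<close> lose only 2, but start at \<open>q 1 + q 2\<close>, which is at least 2
      below \<open>w\<close>.\<close>
    show "(\<Sum>v\<in>N. q v - card (C v)) + 4 \<le> w" if "N \<in> G7_max_cliques" for N
      using that pos unfolding G7_max_cliques_def
      by (elim insertE emptyE) (simp_all add: C_def weights)
  qed simp
qed

end
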